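(* (i) Suppose $w_k:\mathcal{P}_2(E)\to\mathbb{R}$, $k=0,\ldots,n$, is a sequence of real-valued functions satisfying $$w_n(\mu)=\hat g(\mu),\qquad w_k(\mu)=\inf_{\tilde\alpha\in A^E}\Big[\hat f_k(\mu,\tilde\alpha)+w_{k+1}\big(\Phi_{k+1}(\mu,\tilde\alpha)\big)\Big],\quad k=0,\ldots,n-1,\ \mu\in\mathcal{P}_2(E).$$ Then $V_k^\alpha=w_k(\mathbb{P}_{X_k^\alpha})$ for all $k=0,\ldots,n$ and all $\alpha\in\mathcal{A}$, and thus $w_k=v_k$ for all $k=0,\ldots,n$. (ii) Suppose moreover that for every $k=0,\ldots,n-1$ and every $\mu\in\mathcal{P}_2(E)$ the infimum defining $w_k(\mu)$ above is attained by some $\tilde\alpha_k^*(\cdot,\mu)\in A^E$. Let $\alpha^*\in\mathcal{A}$ be the feedback control defined by induction by $\alpha_k^*=\tilde\alpha_k^*\big(X_k^{\alpha^*},\mathbb{P}_{X_k^{\alpha^*}}\big)$, $k=0,\ldots,n-1$. Then $V_0=J(\alpha^* )$, i.e. $\alpha^*$ is an optimal control.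
   Context: Setting. $(E,|\cdot|)$ is a normed space and $(A,|\cdot|)$ is a normed space (typically a subset of $\mathbb{R}^m$), with $\sigma$-algebras $\mathcal{B}(E)$, $\mathcal{B}(A)$. $\mathcal{P}(E)$, $\mathcal{P}(A)$ are the sets of probability measures on $E$, $A$; $\|\mu\|_2^2:=\int|x|^2\mu(dx)$, and $\mathcal{P}_2(E)$ (resp. $\mathcal{P}_2(A)$) is the set of $\mu$ with $\|\mu\|_2<\infty$. On a probability space $(\Omega,\mathcal{F},\mathbb{P})$, $(\varepsilon_k)_{k\ge1}$ is an i.i.d. sequence of $\mathbb{R}^d$-valued random variables, independent of a square integrable $E$-valued random variable $\xi$. $\mathbb{P}_Y$ denotes the law of a random variable $Y$. The maps $F_{k+1}:E\times\mathcal{P}(E)\times A\times\mathcal{P}(A)\times\mathbb{R}^d\to E$, $k\in\mathbb{N}$, are measurable, and $P_{k+1}(x,\mu,a,\lambda,dx')$ denotes the law of $F_{k+1}(x,\mu,a,\lambda,\varepsilon_{k+1})$. Standing assumptions. For each $k\in\mathbb{N}$ there is a constant $C_{k,F}>0$ with $\mathbb{E}\big[|F_{k+1}(x,\mu,a,\lambda,\varepsilon_{k+1})|^2\big]\le C_{k,F}(1+|x|^2+|a|^2+\|\mu\|_2^2+\|\lambda\|_2^2)$ for all $(x,\mu,a,\lambda)$. A horizon $n\ge1$ is fixed. The functions $f_k:E\times\mathcal{P}_2(E)\times A\times\mathcal{P}_2(A)\to\mathbb{R}$ ($k=0,\ldots,n-1$) and $g:E\times\mathcal{P}_2(E)\to\mathbb{R}$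 are measurable with $|f_k(x,\mu,a,\lambda)|\le C_{k,f}(1+|x|^2+|a|^2+\|\mu\|_2^2+\|\lambda\|_2^2)$ and $|g(x,\mu)|\le C_g(1+|x|^2+\|\mu\|_2^2)$ for some positive constants. Controls. $A^E$ is the set of measurable functions $\tilde\alpha:E\to A$ with linear growth ($|\tilde\alpha(x)|\le C(1+|x|)$ for some $C$). $\mathcal{A}$ is the set of feedback controls, identified with sequences $\alpha=(\tilde\alpha_k)_{k\in\mathbb{N}}$ in $A^E$; the associated state process is $X_0^\alpha=\xi$, $X_{k+1}^\alpha=F_{k+1}(X_k^\alpha,\mathbb{P}_{X_k^\alpha},\alpha_k,\mathbb{P}_{\alpha_k},\varepsilon_{k+1})$ with $\alpha_k=\tilde\alpha_k(X_k^\alpha)$ (the feedback functions may be chosen depending on the deterministic law $\mathbb{P}_{X_k^\alpha}$; only the functions $\tilde\alpha_0,\ldots,\tilde\alpha_{n-1}$ matter for the cost). Under the assumptions $\mathbb{P}_{X_k^\alpha}\in\mathcal{P}_2(E)$ for all $k$. For $\tilde\alpha\in A^E$ and $\mu\in\mathcal{P}_2(E)$, $\tilde\alpha\star\mu\in\mathcal{P}_2(A)$ is the image (pushforward) of $\mu$ by $\tilde\alpha$. Cost. $J(\alpha):=\mathbb{E}\big[\sum_{k=0}^{n-1}f_k(X_k^\alpha,\mathbb{P}_{X_k^\alpha},\alpha_k,\mathbb{P}_{\alpha_k})+g(X_n^\alpha,\mathbb{P}_{X_n^\alpha})\big]$ and $V_0:=\inf_{\alpha\in\mathcal{A}}J(\alpha)$.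 Deterministic reformulation. $\hat f_k(\mu,\tilde\alpha):=\int_E f_k(x,\mu,\tilde\alpha(x),\tilde\alpha\star\mu)\,\mu(dx)$, $\hat g(\mu):=\int_E g(x,\mu)\,\mu(dx)$, and $\Phi_{k+1}(\mu,\tilde\alpha)(dx'):=\int_E\mu(dx)\,P_{k+1}(x,\mu,\tilde\alpha(x),\tilde\alpha\star\mu,dx')$, an element of $\mathcal{P}_2(E)$, for $\mu\in\mathcal{P}_2(E)$, $\tilde\alpha\in A^E$. For $\alpha\in\mathcal{A}$ and $k=0,\ldots,n$, $\mathcal{A}_k(\alpha)=\{\beta\in\mathcal{A}:\beta_j=\alpha_j,\ j=0,\ldots,k-1\}$ (so $\mathcal{A}_0(\alpha)=\mathcal{A}$), and $$V_k^\alpha:=\inf_{\beta\in\mathcal{A}_k(\alpha)}\Big[\sum_{j=k}^{n-1}\hat f_j(\mathbb{P}_{X_j^\beta},\tilde\beta_j)+\hat g(\mathbb{P}_{X_n^\beta})\Big].$$ The value functions $v_k$ on $\mathcal{P}_2(E)$ (a priori valued in $[-\infty,\infty)$) are defined by backward recursion: $v_n=\hat g$, $v_k(\mu)=\inf_{\tilde\alpha\in A^E}[\hat f_k(\mu,\tilde\alpha)+v_{k+1}(\Phi_{k+1}(\mu,\tilde\alpha))]$. *)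

theory Defs
  imports "HOL-Probability.Probability"
begin

text \<open>The square of \<open>\<parallel>\<mu>\<parallel>\<^sub>2\<close>, possibly infinite.\<close>

definition second_moment :: "'x::real_normed_vector measure \<Rightarrow> ennreal" where
  "second_moment \<mu> = (\<integral>\<^sup>+x. ennreal ((norm x)\<^sup>2) \<partial>\<mu>)"

definition P2 :: "'x::real_normed_vector measure \<Rightarrow> 'x measure set" where
  "P2 S = {\<mu> \<in> space (prob_algebra S). second_moment \<mu> < \<infinity>}"

text \<open>The action space is a nonempty subset \<open>A\<close> of a normed space, with its Borel sigma-algebra;
  the case of a whole normed space is \<open>A = UNIV\<close>.\<close>

abbreviation act_space :: "'a::real_normed_vector set \<Rightarrow> 'a measure" where
  "act_space A \<equiv> restrict_space borel A"

definition feedback :: "'a::real_normed_vector set \<Rightarrow> ('e::real_normed_vector \<Rightarrow> 'a) set" where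
  "feedback A = {h \<in> borel \<rightarrow>\<^sub>M act_space A. \<exists>C. \<forall>x. norm (h x) \<le> C * (1 + norm x)}"

definition controls :: "'a::real_normed_vector set \<Rightarrow> (nat \<Rightarrow> 'e::real_normed_vector \<Rightarrow> 'a) set" where
  "controls A = {\<alpha>. \<forall>k. \<alpha> k \<in> feedback A}"

text \<open>\<open>A\<^sub>k(\<alpha>)\<close>; controls are identified with their sequences of feedback functions.\<close>

definition controls_upto ::
  "'a::real_normed_vector set \<Rightarrow> nat \<Rightarrow> (nat \<Rightarrow> 'e::real_normed_vector \<Rightarrow> 'a) \<Rightarrow> (nat \<Rightarrow> 'e \<Rightarrow> 'a) set" where
  "controls_upto A k \<alpha> = {\<beta> \<in> controls A. \<forall>j<k. \<beta> j = \<alpha> j}"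

text \<open>Spaces of probability measures carry the sigma-algebra generated by the evaluations
  \<open>\<mu> \<mapsto> \<mu>(B)\<close>, and their subsets the trace sigma-algebra. \<open>F\<close> and \<open>eps\<close> are indexed from 1:
  the step from time \<open>k\<close> to \<open>k + 1\<close> uses \<open>F (Suc k)\<close> and \<open>eps (Suc k)\<close>. The growth bounds are
  stated in \<open>ennreal\<close>, so the one on \<open>F\<close> is void at measures with infinite second moment.\<close>

locale mkv_control = prob_space M for M :: "'o measure" +
  fixes A :: "'a::real_normed_vector set"
    and xi :: "'o \<Rightarrow> 'e::real_normed_vector"
    and eps :: "nat \<Rightarrow> 'o \<Rightarrow> real ^ 'd"
    and F :: "nat \<Rightarrow> 'e \<Rightarrow> 'e measure \<Rightarrow> 'a \<Rightarrow> 'a measure \<Rightarrow> real ^ 'd \<Rightarrow> 'e"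
    and f :: "nat \<Rightarrow> 'e \<Rightarrow> 'e measure \<Rightarrow> 'a \<Rightarrow> 'a measure \<Rightarrow> real"
    and g :: "'e \<Rightarrow> 'e measure \<Rightarrow> real"
    and n :: nat
  assumes A_nonempty: "A \<noteq> {}"
    and n_pos: "1 \<le> n"
    and xi_measurable: "xi \<in> borel_measurable M"
    and xi_square_integrable: "integrable M (\<lambda>\<omega>. (norm (xi \<omega>))\<^sup>2)"
    and eps_indep: "indep_vars (\<lambda>_. borel) eps {1..}"
    and eps_ident: "\<And>k. 1 \<le> k \<Longrightarrow> distr M borel (eps k) = distr M borel (eps 1)"
    and eps_indep_xi:
      "indep_set (sets (vimage_algebra (space M) xi borel))
         (sets (vimage_algebra (space M) (\<lambda>\<omega>. \<lambda>k\<in>{1..}. eps k \<omega>) (\<Pi>\<^sub>M k\<in>{1..}. borel)))"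
    and F_measurable: "\<And>k. (\<lambda>(x, \<mu>, a, l, e). F (Suc k) x \<mu> a l e) \<in>
      borel \<Otimes>\<^sub>M prob_algebra borel \<Otimes>\<^sub>M act_space A \<Otimes>\<^sub>M prob_algebra (act_space A) \<Otimes>\<^sub>M borel \<rightarrow>\<^sub>M borel"
    and F_growth: "\<And>k. \<exists>C>0. \<forall>x. \<forall>\<mu>\<in>space (prob_algebra borel). \<forall>a\<in>A.
      \<forall>l\<in>space (prob_algebra (act_space A)).
        (\<integral>\<^sup>+\<omega>. ennreal ((norm (F (Suc k) x \<mu> a l (eps (Suc k) \<omega>)))\<^sup>2) \<partial>M)
          \<le> ennreal C * (1 + ennreal ((norm x)\<^sup>2) + ennreal ((norm a)\<^sup>2)
               + second_moment \<mu> + second_moment l)"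
    and f_measurable: "\<And>k. k < n \<Longrightarrow> (\<lambda>(x, \<mu>, a, l). f k x \<mu> a l) \<in>
      borel \<Otimes>\<^sub>M restrict_space (prob_algebra borel) (P2 borel) \<Otimes>\<^sub>M act_space A
        \<Otimes>\<^sub>M restrict_space (prob_algebra (act_space A)) (P2 (act_space A)) \<rightarrow>\<^sub>M borel"
    and f_growth: "\<And>k. k < n \<Longrightarrow> \<exists>C>0. \<forall>x. \<forall>\<mu>\<in>P2 borel. \<forall>a\<in>A. \<forall>l\<in>P2 (act_space A).
        ennreal \<bar>f k x \<mu> a l\<bar>
          \<le> ennreal C * (1 + ennreal ((norm x)\<^sup>2) + ennreal ((norm a)\<^sup>2)
               + second_moment \<mu> + second_moment l)"
    and g_measurable: "(\<lambda>(x, \<mu>). g x \<mu>) \<in>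
      borel \<Otimes>\<^sub>M restrict_space (prob_algebra borel) (P2 borel) \<rightarrow>\<^sub>M borel"
    and g_growth: "\<exists>C>0. \<forall>x. \<forall>\<mu>\<in>P2 borel.
        ennreal \<bar>g x \<mu>\<bar> \<le> ennreal C * (1 + ennreal ((norm x)\<^sup>2) + second_moment \<mu>)"
begin

primrec X :: "(nat \<Rightarrow> 'e \<Rightarrow> 'a) \<Rightarrow> nat \<Rightarrow> 'o \<Rightarrow> 'e" where
  "X \<alpha> 0 = xi"
| "X \<alpha> (Suc k) = (\<lambda>\<omega>. F (Suc k) (X \<alpha> k \<omega>) (distr M borel (X \<alpha> k)) (\<alpha> k (X \<alpha> k \<omega>))
     (distr M (act_space A) (\<lambda>\<omega>'. \<alpha> k (X \<alpha> k \<omega>'))) (eps (Suc k) \<omega>))"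

definition law :: "(nat \<Rightarrow> 'e \<Rightarrow> 'a) \<Rightarrow> nat \<Rightarrow> 'e measure" where
  "law \<alpha> k = distr M borel (X \<alpha> k)"

definition act_law :: "(nat \<Rightarrow> 'e \<Rightarrow> 'a) \<Rightarrow> nat \<Rightarrow> 'a measure" where
  "act_law \<alpha> k = distr M (act_space A) (\<lambda>\<omega>. \<alpha> k (X \<alpha> k \<omega>))"

definition J :: "(nat \<Rightarrow> 'e \<Rightarrow> 'a) \<Rightarrow> real" where
  "J \<alpha> = expectation (\<lambda>\<omega>.
     (\<Sum>k<n. f k (X \<alpha> k \<omega>) (law \<alpha> k) (\<alpha> k (X \<alpha> k \<omega>)) (act_law \<alpha> k)) + g (X \<alpha> n \<omega>) (law \<alpha> n))"

definition V0 :: ereal where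
  "V0 = (INF \<alpha>\<in>controls A. ereal (J \<alpha>))"

definition kernel_P :: "nat \<Rightarrow> 'e \<Rightarrow> 'e measure \<Rightarrow> 'a \<Rightarrow> 'a measure \<Rightarrow> 'e measure" where
  "kernel_P k x \<mu> a l = distr M borel (\<lambda>\<omega>. F k x \<mu> a l (eps k \<omega>))"

definition push :: "('e \<Rightarrow> 'a) \<Rightarrow> 'e measure \<Rightarrow> 'a measure" where
  "push h \<mu> = distr \<mu> (act_space A) h"

definition fhat :: "nat \<Rightarrow> 'e measure \<Rightarrow> ('e \<Rightarrow> 'a) \<Rightarrow> real" where
  "fhat k \<mu> h = (\<integral>x. f k x \<mu> (h x) (push h \<mu>) \<partial>\<mu>)"

definition ghat :: "'e measure \<Rightarrow> real" where
  "ghat \<mu> = (\<integral>x. g x \<mu> \<partial>\<mu>)"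

definition Phi :: "nat \<Rightarrow> 'e measure \<Rightarrow> ('e \<Rightarrow> 'a) \<Rightarrow> 'e measure" where
  "Phi k \<mu> h = \<mu> \<bind> (\<lambda>x. kernel_P k x \<mu> (h x) (push h \<mu>))"

definition V :: "nat \<Rightarrow> (nat \<Rightarrow> 'e \<Rightarrow> 'a) \<Rightarrow> ereal" where
  "V k \<alpha> = (INF \<beta>\<in>controls_upto A k \<alpha>.
     ereal ((\<Sum>j=k..<n. fhat j (law \<beta> j) (\<beta> j)) + ghat (law \<beta> n)))"

function v :: "nat \<Rightarrow> 'e measure \<Rightarrow> ereal" where
  "v k \<mu> = (if k < n then INF h\<in>feedback A. ereal (fhat k \<mu> h) + v (Suc k) (Phi (Suc k) \<mu> h)
            else ereal (ghat \<mu>))"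
  by pat_completeness auto
termination by (relation "Wellfounded.measure (\<lambda>(k, \<mu>). n - k)") auto

declare v.simps [simp del]

end

end

theory Submission
  imports Defs
begin

text \<open>Since \<open>X\<^sub>k\<close> is a function of \<open>\<xi>, \<epsilon>\<^sub>1, \<dots>, \<epsilon>\<^sub>k\<close>, it is independent of \<open>\<epsilon>\<^sub>k\<^sub>+\<^sub>1\<close>, so the
  laws of the state process form a deterministic controlled system driven by \<open>\<Phi>\<close> and the cost
  is a sum of functions of these laws. Backward induction with near-minimisers, which exist
  because \<open>w\<close> is real-valued, then gives the dynamic programming principle; with exact
  minimisers the inequalities along the closed loop become equalities.\<close>

section \<open>Second moments, image laws and growth of feedback functions\<close>

lemma norm_measurable_act_space [measurable]: "norm \<in> borel_measurable (act_space A)"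
  by (intro measurable_restrict_space1 borel_measurable_norm measurable_ident)

text \<open>Preimages commute with intersections. Stability is what allows independence of families
  of events to pass to the sigma-algebras that blocks of them generate.\<close>

lemma Int_stable_vimage_sets: "Int_stable {X -` B \<inter> \<Omega> | B. B \<in> sets N}"
proof (rule Int_stableI)
  fix a b assume "a \<in> {X -` B \<inter> \<Omega> | B. B \<in> sets N}" "b \<in> {X -` B \<inter> \<Omega> | B. B \<in> sets N}"
  then obtain B C where BC: "B \<in> sets N" "C \<in> sets N" "a = X -` B \<inter> \<Omega>" "b = X -` C \<inter> \<Omega>"
    by blast
  have "a \<inter> b = X -` (B \<inter> C) \<inter> \<Omega>" unfolding BC by blast
  moreover have "B \<inter> C \<in> sets N" using BC by blast
  ultimately show "a \<inter> b \<in> {X -` B \<inter> \<Omega> | B. B \<in> sets N}" by blast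
qed

lemma P2_D:
  assumes "\<mu> \<in> P2 S"
  shows "\<mu> \<in> space (prob_algebra S)" "second_moment \<mu> < \<infinity>" "prob_space \<mu>" "sets \<mu> = sets S"
  using assms by (auto simp: P2_def space_prob_algebra)

lemma distr_in_prob_algebra:
  assumes "prob_space M" "X \<in> M \<rightarrow>\<^sub>M S"
  shows "distr M S X \<in> space (prob_algebra S)"
  using assms by (simp add: space_prob_algebra prob_space.prob_space_distr)

lemma second_moment_distr:
  assumes "X \<in> M \<rightarrow>\<^sub>M S" "norm \<in> borel_measurable S"
  shows "second_moment (distr M S X) = (\<integral>\<^sup>+\<omega>. ennreal ((norm (X \<omega>))\<^sup>2) \<partial>M)"
  unfolding second_moment_def using assms by (subst nn_integral_distr) auto

lemma feedback_measurable:
  "h \<in> feedback A \<Longrightarrow> h \<in> borel \<rightarrow>\<^sub>M act_space A"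
  by (simp add: feedback_def)

lemma feedback_range: "h \<in> feedback A \<Longrightarrow> h x \<in> A"
  using measurable_space[OF feedback_measurable, of h A x] by (simp add: space_restrict_space)

text \<open>Squares the linear growth bound using \<open>(1 + t)^2\<close> \<le>
  \<open>2 * (1 + t^2)\<close>, because every moment condition is phrased with squared
  norms.\<close>

lemma feedback_square_growth:
  assumes "h \<in> feedback A"
  obtains C where "C \<ge> 0" "\<And>x. (norm (h x))\<^sup>2 \<le> C * (1 + (norm x)\<^sup>2)"
proof -
  obtain C where C: "\<And>x. norm (h x) \<le> C * (1 + norm x)"
    using assms by (auto simp: feedback_def)
  have "(norm (h x))\<^sup>2 \<le> (2 * C\<^sup>2) * (1 + (norm x)\<^sup>2)" for x
  proof -
    have "(norm (h x))\<^sup>2 \<le> (C * (1 + norm x))\<^sup>2"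
      using C by (intro power_mono) auto
    also have "\<dots> = C\<^sup>2 * (1 + norm x)\<^sup>2" by (simp add: power_mult_distrib)
    also have "\<dots> \<le> C\<^sup>2 * (2 * (1 + (norm x)\<^sup>2))"
      using sum_squares_bound[of 1 "norm x"]
      by (intro mult_left_mono) (auto simp: power2_eq_square algebra_simps)
    finally show ?thesis by (simp add: algebra_simps)
  qed
  then show ?thesis by (intro that[of "2 * C\<^sup>2"]) auto
qed

lemma controls_feedback: "\<alpha> \<in> controls A \<Longrightarrow> \<alpha> k \<in> feedback A"
  by (simp add: controls_def)

lemma controls_fun_upd: "\<alpha> \<in> controls A \<Longrightarrow> h \<in> feedback A \<Longrightarrow> \<alpha>(k := h) \<in> controls A"
  by (simp add: controls_def)

context mkv_control
begin

section \<open>Measurability of the state process and of its controls\<close>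

lemma eps_measurable: "eps (Suc k) \<in> borel_measurable M"
  using eps_indep by (auto simp: indep_vars_def2)

text \<open>The two measure arguments are constants, as laws along the process are deterministic.
  The source \<open>N\<close> is left general so that it can be \<open>M\<close>, a past
  sigma-algebra or a product space.\<close>

lemma F_measurable_comp:
  assumes "\<mu> \<in> space (prob_algebra borel)" "l \<in> space (prob_algebra (act_space A))"
    and "x \<in> borel_measurable N" "a \<in> N \<rightarrow>\<^sub>M act_space A" "e \<in> borel_measurable N"
  shows "(\<lambda>\<omega>. F (Suc k) (x \<omega>) \<mu> (a \<omega>) l (e \<omega>)) \<in> borel_measurable N"
proof -
  have "(\<lambda>\<omega>. (x \<omega>, \<mu>, a \<omega>, l, e \<omega>)) \<in> N \<rightarrow>\<^sub>M
      borel \<Otimes>\<^sub>M prob_algebra borel \<Otimes>\<^sub>M act_space A \<Otimes>\<^sub>M prob_algebra (act_space A) \<Otimes>\<^sub>M borel"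
    using assms by (intro measurable_Pair measurable_const) auto
  from measurable_compose[OF this F_measurable[of k]] show ?thesis by simp
qed

lemma X_measurable:
  assumes "\<alpha> \<in> controls A"
  shows "X \<alpha> k \<in> borel_measurable M"
proof (induction k)
  case 0
  show ?case using xi_measurable by simp
next
  case (Suc k)
  have a: "(\<lambda>\<omega>. \<alpha> k (X \<alpha> k \<omega>)) \<in> M \<rightarrow>\<^sub>M act_space A"
    by (rule measurable_compose[OF Suc feedback_measurable[OF controls_feedback[OF assms]]])
  show ?case unfolding X.simps
    by (intro F_measurable_comp distr_in_prob_algebra prob_space_axioms a Suc eps_measurable)
qed

lemma act_measurable:
  assumes "\<alpha> \<in> controls A"
  shows "(\<lambda>\<omega>. \<alpha> k (X \<alpha> k \<omega>)) \<in> M \<rightarrow>\<^sub>M act_space A"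
  by (rule measurable_compose[OF X_measurable[OF assms] feedback_measurable[OF controls_feedback[OF assms]]])

lemma law_prob_algebra: "\<alpha> \<in> controls A \<Longrightarrow> law \<alpha> k \<in> space (prob_algebra borel)"
  unfolding law_def by (intro distr_in_prob_algebra prob_space_axioms X_measurable)

lemma act_law_prob_algebra: "\<alpha> \<in> controls A \<Longrightarrow> act_law \<alpha> k \<in> space (prob_algebra (act_space A))"
  unfolding act_law_def by (intro distr_in_prob_algebra prob_space_axioms act_measurable)

lemma act_law_eq_push: "\<alpha> \<in> controls A \<Longrightarrow> act_law \<alpha> k = push (\<alpha> k) (law \<alpha> k)"
  unfolding act_law_def push_def law_def
  by (subst distr_distr) (auto simp: comp_def intro: X_measurable feedback_measurable controls_feedback)

lemma X_Suc: "X \<alpha> (Suc k) = (\<lambda>\<omega>. F (Suc k) (X \<alpha> k \<omega>) (law \<alpha> k) (\<alpha> k (X \<alpha> k \<omega>)) (act_law \<alpha> k) (eps (Suc k) \<omega>))"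
  by (simp add: law_def act_law_def)

subsection \<open>Independence of the state and the next innovation\<close>

text \<open>Index 0 carries the events of \<open>xi\<close> and index k > 0 those of
  \<open>eps k\<close>. Working with events puts two random sources of different types into one
  family indexed by the naturals.\<close>

definition noise :: "nat \<Rightarrow> 'o set set" where
  "noise k = (if k = 0 then {xi -` B \<inter> space M | B. B \<in> sets borel}
              else {eps k -` B \<inter> space M | B. B \<in> sets borel})"

lemma noise_events: "noise k \<subseteq> events"
  using xi_measurable eps_measurable[of "k - 1"] by (cases k) (auto simp: noise_def intro: measurable_sets)

lemma Int_stable_noise: "Int_stable (noise k)"
  unfolding noise_def by (simp add: Int_stable_vimage_sets)

text \<open>Merges the two independence hypotheses: the factor at index 0 is split off by the
  independence of \<open>xi\<close> from the whole innovation sequence, and the remaining factors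
  multiply by the mutual independence of the innovations.\<close>

lemma indep_noise: "indep_sets noise UNIV"
proof (rule indep_setsI)
  show "noise i \<subseteq> events" for i by (rule noise_events)
next
  fix E :: "nat \<Rightarrow> 'o set" and J :: "nat set"
  assume J: "J \<noteq> {}" "J \<subseteq> UNIV" "finite J" and E: "\<forall>j\<in>J. E j \<in> noise j"
  define J' where "J' = J - {0}"
  have indep_eps: "indep_sets noise {1..}"
  proof -
    have "indep_sets (\<lambda>i. {eps i -` B \<inter> space M | B. B \<in> sets borel}) {1..}"
      using eps_indep by (simp add: indep_vars_def2)
    then show ?thesis
      by (subst indep_sets_cong[where G = "\<lambda>i. {eps i -` B \<inter> space M | B. B \<in> sets borel}"])
        (auto simp: noise_def)
  qed
  have J'_prob: "prob (\<Inter>j\<in>J'. E j) = (\<Prod>j\<in>J'. prob (E j))" if "J' \<noteq> {}"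
    using J E that by (intro indep_setsD[OF indep_eps]) (auto simp: J'_def)
  show "prob (\<Inter>j\<in>J. E j) = (\<Prod>j\<in>J. prob (E j))"
  \<comment> \<open>Only a family mixing index 0 with positive indices needs
    \<open>eps_indep_xi\<close>; otherwise \<open>indep_eps\<close> applies, or there is a single
    factor.\<close>
  proof (cases "0 \<in> J \<and> J' \<noteq> {}")
    case False
    then have "J = J' \<or> J = {0}" using J by (auto simp: J'_def)
    then show ?thesis using J'_prob J by auto
  next
    case True
    define S where "S = (\<lambda>\<omega>. \<lambda>k\<in>{1..}. eps k \<omega>)"
    let ?VX = "vimage_algebra (space M) xi borel"
    let ?V = "vimage_algebra (space M) S (\<Pi>\<^sub>M k\<in>{1..}. borel)"
    have S: "S \<in> ?V \<rightarrow>\<^sub>M (\<Pi>\<^sub>M k\<in>{1..}. borel)"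
      by (rule measurable_vimage_algebra1) (auto simp: S_def space_PiM)
    \<comment> \<open>A coordinate of the sequence is measurable for the sigma-algebra of the whole
      sequence, so each innovation event, and then their finite intersection, lies on the side that
      is independent of \<open>xi\<close>.\<close>
    have "E j \<in> sets ?V" if j: "j \<in> J'" for j
    proof -
      obtain B where B: "B \<in> sets borel" "E j = eps j -` B \<inter> space M"
        using E j by (force simp: J'_def noise_def)
      have "(\<lambda>\<omega>. S \<omega> j) \<in> ?V \<rightarrow>\<^sub>M borel"
        using j by (intro measurable_compose[OF S measurable_component_singleton]) (auto simp: J'_def)
      from measurable_sets[OF this B(1)] show ?thesis
        using j B by (simp add: S_def J'_def vimage_def)
    qed
    then have "(\<Inter>j\<in>J'. E j) \<in> sets ?V"
      using True J by (intro sets.finite_INT) (auto simp: J'_def)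
    moreover have "E 0 \<in> sets ?VX"
    proof -
      obtain B where "B \<in> sets borel" "E 0 = xi -` B \<inter> space M"
        using E True by (force simp: noise_def)
      then show ?thesis by (simp add: in_vimage_algebra)
    qed
    ultimately have "prob (E 0 \<inter> (\<Inter>j\<in>J'. E j)) = prob (E 0) * prob (\<Inter>j\<in>J'. E j)"
      using eps_indep_xi by (intro indep_setD) (auto simp: S_def)
    moreover have "J = insert 0 J'" "0 \<notin> J'" "finite J'"
      using True J by (auto simp: J'_def)
    ultimately show ?thesis using J'_prob True by simp
  qed
qed

text \<open>The sigma-algebra of \<open>xi\<close> and the first k innovations, packaged as a
  measure so that adaptedness can be stated as measurability.\<close>

definition past :: "nat \<Rightarrow> 'o measure" where
  "past k = sigma (space M) (\<Union>i\<in>{..k}. noise i)"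

lemma noise_subset: "(\<Union>i\<in>I. noise i) \<subseteq> Pow (space M)"
  using noise_events sets.sets_into_space by blast

lemma space_past: "space (past k) = space M"
  using noise_subset by (simp add: past_def space_measure_of)

lemma sets_past: "sets (past k) = sigma_sets (space M) (\<Union>i\<in>{..k}. noise i)"
  using noise_subset by (simp add: past_def sets_measure_of)

lemma past_mono: "sets (past k) \<subseteq> sets (past (Suc k))"
  unfolding sets_past by (intro sigma_sets_mono' UN_mono) auto

text \<open>Since the laws in the recursion are constants, a step adds no randomness beyond
  \<open>eps (Suc k)\<close>.\<close>

lemma X_adapted:
  assumes \<alpha>: "\<alpha> \<in> controls A"
  shows "X \<alpha> k \<in> borel_measurable (past k)"
proof (induction k)
  case 0
  have "xi -` B \<inter> space M \<in> sets (past 0)" if "B \<in> sets borel" for B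
    unfolding sets_past using that by (intro sigma_sets.Basic) (auto simp: noise_def)
  then show ?case by (auto intro: measurableI simp: space_past)
next
  case (Suc k)
  have "eps (Suc k) -` B \<inter> space M \<in> sets (past (Suc k))" if "B \<in> sets borel" for B
    unfolding sets_past using that by (intro sigma_sets.Basic) (auto simp: noise_def)
  then have e: "eps (Suc k) \<in> borel_measurable (past (Suc k))"
    by (auto intro: measurableI simp: space_past)
  have x: "X \<alpha> k \<in> borel_measurable (past (Suc k))"
    using Suc measurable_mono[OF order_refl refl past_mono[of k], of borel] by (auto simp: space_past)
  show ?case unfolding X_Suc
    by (intro F_measurable_comp law_prob_algebra act_law_prob_algebra \<alpha> x e
        measurable_compose[OF x feedback_measurable[OF controls_feedback[OF \<alpha>]]])
qed

text \<open>Stated through the joint law because \<open>indep_var\<close> only relates random variables of the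
  same type.\<close>

lemma distr_X_eps:
  assumes \<alpha>: "\<alpha> \<in> controls A"
  shows "distr M (borel \<Otimes>\<^sub>M borel) (\<lambda>\<omega>. (X \<alpha> k \<omega>, eps (Suc k) \<omega>)) = law \<alpha> k \<Otimes>\<^sub>M distr M borel (eps (Suc k))"
    (is "?P = _ \<Otimes>\<^sub>M ?D")
proof (rule pair_measure_eqI[symmetric])
  note [measurable] = X_measurable[OF \<alpha>] eps_measurable
  interpret L: prob_space "law \<alpha> k" unfolding law_def by (rule prob_space_distr) measurable
  interpret D: prob_space ?D by (rule prob_space_distr) measurable
  show "sigma_finite_measure (law \<alpha> k)" by (rule L.sigma_finite_measure_axioms)
  show "sigma_finite_measure ?D" by (rule D.sigma_finite_measure_axioms)
  show "sets (law \<alpha> k \<Otimes>\<^sub>M ?D) = sets ?P"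
    unfolding law_def sets_distr by (intro sets_pair_measure_cong) auto
next
  note [measurable] = X_measurable[OF \<alpha>] eps_measurable
  fix B C assume "B \<in> sets (law \<alpha> k)" "C \<in> sets ?D"
  then have [measurable]: "B \<in> sets borel" "C \<in> sets borel" by (auto simp: law_def)
  \<comment> \<open>Grouping the independent family along these two disjoint index blocks makes the
    past up to time k independent of the next innovation.\<close>
  let ?I = "case_bool {..k} {Suc k}"
  have "indep_sets (\<lambda>b. sigma_sets (space M) (\<Union>i\<in>?I b. noise i)) UNIV"
    by (intro indep_sets_collect_sigma indep_sets_mono_index[OF _ indep_noise] Int_stable_noise)
      (auto simp: disjoint_family_on_def split: bool.splits)
  then have "indep_set (sets (past k)) (sigma_sets (space M) (noise (Suc k)))"
    unfolding indep_set_def sets_past by (rule indep_sets_mono_sets) (auto split: bool.splits)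
  moreover have "X \<alpha> k -` B \<inter> space M \<in> sets (past k)"
    using measurable_sets[OF X_adapted[OF \<alpha>, of k], of B] by (simp add: space_past)
  moreover have "eps (Suc k) -` C \<inter> space M \<in> sigma_sets (space M) (noise (Suc k))"
    by (intro sigma_sets.Basic) (auto simp: noise_def)
  ultimately have "prob ((X \<alpha> k -` B \<inter> space M) \<inter> (eps (Suc k) -` C \<inter> space M))
      = prob (X \<alpha> k -` B \<inter> space M) * prob (eps (Suc k) -` C \<inter> space M)"
    by (rule indep_setD)
  moreover have "(\<lambda>\<omega>. (X \<alpha> k \<omega>, eps (Suc k) \<omega>)) -` (B \<times> C) \<inter> space M
      = (X \<alpha> k -` B \<inter> space M) \<inter> (eps (Suc k) -` C \<inter> space M)" by auto
  ultimately show "emeasure (law \<alpha> k) B * emeasure ?D C = emeasure ?P (B \<times> C)"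
    by (simp add: law_def emeasure_distr emeasure_eq_measure ennreal_mult)
qed

subsection \<open>The deterministic dynamics of the laws\<close>

text \<open>The quadratic growth bound of \<open>h\<close> is integrated against the probability
  measure \<mu>.\<close>

lemma push_P2:
  assumes \<mu>: "\<mu> \<in> P2 borel" and h: "h \<in> feedback A"
  shows "push h \<mu> \<in> P2 (act_space A)"
proof -
  note [measurable_cong] = P2_D(4)[OF \<mu>]
  have hm: "h \<in> \<mu> \<rightarrow>\<^sub>M act_space A"
    using feedback_measurable[OF h] by (simp cong: measurable_cong_sets add: P2_D(4)[OF \<mu>])
  obtain C where C: "C \<ge> 0" "\<And>x. (norm (h x))\<^sup>2 \<le> C * (1 + (norm x)\<^sup>2)"
    using feedback_square_growth[OF h] by blast
  have "second_moment (push h \<mu>) = (\<integral>\<^sup>+x. ennreal ((norm (h x))\<^sup>2) \<partial>\<mu>)"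
    unfolding push_def by (rule second_moment_distr[OF hm]) measurable
  also have "\<dots> \<le> (\<integral>\<^sup>+x. ennreal C * (1 + ennreal ((norm x)\<^sup>2)) \<partial>\<mu>)"
  proof (rule nn_integral_mono)
    fix x
    have "ennreal ((norm (h x))\<^sup>2) \<le> ennreal (C * (1 + (norm x)\<^sup>2))"
      by (rule ennreal_leI[OF C(2)])
    also have "\<dots> = ennreal C * (1 + ennreal ((norm x)\<^sup>2))"
      using C(1) by (simp add: ennreal_mult)
    finally show "ennreal ((norm (h x))\<^sup>2) \<le> ennreal C * (1 + ennreal ((norm x)\<^sup>2))" .
  qed
  also have "\<dots> = ennreal C * (1 + second_moment \<mu>)"
    using prob_space.emeasure_space_1[OF P2_D(3)[OF \<mu>]]
    by (simp add: nn_integral_cmult nn_integral_add second_moment_def)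
  also have "\<dots> < \<infinity>"
    using P2_D(2)[OF \<mu>] by (simp add: ennreal_mult_less_top)
  finally show ?thesis
    using distr_in_prob_algebra[OF P2_D(3)[OF \<mu>] hm] by (simp add: P2_def push_def)
qed

text \<open>Integrates the bound shared by \<open>F_growth\<close> and \<open>f_growth\<close>, so
  it serves both the stability of \<open>P2\<close> under \<open>Phi\<close> and the integrability
  of the running cost. The squared norm of \<open>h\<close> integrates to the second moment of
  \<open>push h \<mu>\<close>, which is finite by \<open>push_P2\<close>.\<close>

lemma growth_integral_finite:
  assumes \<mu>: "\<mu> \<in> P2 borel" and h: "h \<in> feedback A"
  shows "(\<integral>\<^sup>+x. ennreal C * (1 + ennreal ((norm x)\<^sup>2) + ennreal ((norm (h x))\<^sup>2)
            + second_moment \<mu> + second_moment (push h \<mu>)) \<partial>\<mu>) < \<infinity>"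
proof -
  note [measurable_cong] = P2_D(4)[OF \<mu>]
  note [measurable] = feedback_measurable[OF h]
  have "(\<integral>\<^sup>+x. ennreal ((norm (h x))\<^sup>2) \<partial>\<mu>) = second_moment (push h \<mu>)"
    unfolding push_def by (rule second_moment_distr[symmetric]) measurable
  then have "(\<integral>\<^sup>+x. ennreal C * (1 + ennreal ((norm x)\<^sup>2) + ennreal ((norm (h x))\<^sup>2)
            + second_moment \<mu> + second_moment (push h \<mu>)) \<partial>\<mu>)
      = ennreal C * (1 + second_moment \<mu> + second_moment (push h \<mu>) + second_moment \<mu>
            + second_moment (push h \<mu>))"
    using prob_space.emeasure_space_1[OF P2_D(3)[OF \<mu>]]
    by (simp add: nn_integral_cmult nn_integral_add second_moment_def[of \<mu>])
  then show ?thesis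
    using P2_D(2)[OF \<mu>] P2_D(2)[OF push_P2[OF \<mu> h]] by (simp add: ennreal_mult_less_top)
qed

text \<open>Joint measurability in the state and the sample point yields a measurable probability
  kernel, which gives the bind in \<open>Phi\<close> its meaning as an integral of kernels.\<close>

lemma kernel_measurable:
  assumes \<mu>: "\<mu> \<in> P2 borel" and h: "h \<in> feedback A"
  shows "(\<lambda>x. kernel_P (Suc k) x \<mu> (h x) (push h \<mu>)) \<in> borel \<rightarrow>\<^sub>M prob_algebra borel"
proof (rule measurable_prob_algebraI)
  note [measurable] = feedback_measurable[OF h] eps_measurable
  note F_meas = F_measurable_comp[OF P2_D(1)[OF \<mu>] P2_D(1)[OF push_P2[OF \<mu> h]]]
  show "prob_space (kernel_P (Suc k) x \<mu> (h x) (push h \<mu>))" for x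
    unfolding kernel_P_def
    by (intro prob_space_distr F_meas eps_measurable measurable_const)
      (auto simp: space_restrict_space feedback_range[OF h])
  show "(\<lambda>x. kernel_P (Suc k) x \<mu> (h x) (push h \<mu>)) \<in> borel \<rightarrow>\<^sub>M subprob_algebra borel"
    unfolding kernel_P_def
  proof (rule measurable_distr2)
    show "(\<lambda>(x, \<omega>). F (Suc k) x \<mu> (h x) (push h \<mu>) (eps (Suc k) \<omega>)) \<in> borel_measurable (borel \<Otimes>\<^sub>M M)"
      unfolding case_prod_beta by (intro F_meas) measurable
    show "(\<lambda>x. M) \<in> borel \<rightarrow>\<^sub>M subprob_algebra M"
      by (auto simp: space_subprob_algebra prob_space_imp_subprob_space prob_space_axioms)
  qed
qed

text \<open>The second moment of a mixture is the integral of the second moments of the kernels.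
  \<open>F_growth\<close> bounds each of these, and the bound has a finite integral.\<close>

lemma Phi_P2:
  assumes \<mu>: "\<mu> \<in> P2 borel" and h: "h \<in> feedback A"
  shows "Phi (Suc k) \<mu> h \<in> P2 borel"
proof -
  note pP = push_P2[OF \<mu> h]
  note K = kernel_measurable[OF \<mu> h, of k]
  have K': "(\<lambda>x. kernel_P (Suc k) x \<mu> (h x) (push h \<mu>)) \<in> \<mu> \<rightarrow>\<^sub>M subprob_algebra borel"
    using measurable_prob_algebraD[OF K] by (simp cong: measurable_cong_sets add: P2_D(4)[OF \<mu>])
  obtain C where C: "\<And>x a. a \<in> A \<Longrightarrow>
      (\<integral>\<^sup>+\<omega>. ennreal ((norm (F (Suc k) x \<mu> a (push h \<mu>) (eps (Suc k) \<omega>)))\<^sup>2) \<partial>M)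
          \<le> ennreal C * (1 + ennreal ((norm x)\<^sup>2) + ennreal ((norm a)\<^sup>2)
               + second_moment \<mu> + second_moment (push h \<mu>))"
    using F_growth[of k] P2_D(1)[OF \<mu>] P2_D(1)[OF pP] by blast
  have "second_moment (kernel_P (Suc k) x \<mu> (h x) (push h \<mu>))
      \<le> ennreal C * (1 + ennreal ((norm x)\<^sup>2) + ennreal ((norm (h x))\<^sup>2)
               + second_moment \<mu> + second_moment (push h \<mu>))" for x
    unfolding kernel_P_def
    by (subst second_moment_distr)
      (auto intro!: C F_measurable_comp eps_measurable measurable_const P2_D[OF \<mu>] P2_D[OF pP] feedback_range[OF h]
        simp: space_restrict_space)
  then have "(\<integral>\<^sup>+x. second_moment (kernel_P (Suc k) x \<mu> (h x) (push h \<mu>)) \<partial>\<mu>) < \<infinity>"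
    by (intro le_less_trans[OF nn_integral_mono growth_integral_finite[OF \<mu> h, of C]])
  then have "second_moment (Phi (Suc k) \<mu> h) < \<infinity>"
    unfolding second_moment_def Phi_def by (subst nn_integral_bind[OF _ K']) auto
  then show ?thesis
    using prob_space_bind'[OF P2_D(1)[OF \<mu>] K] sets_bind'[OF P2_D(1)[OF \<mu>] K]
    by (simp add: P2_def space_prob_algebra Phi_def)
qed

text \<open>By \<open>distr_X_eps\<close> the state and the next innovation have a product law;
  integrating over the innovation first leaves the transition kernel, and integrating over the state
  gives the bind. Membership in \<open>P2\<close> is assumed here because \<open>law_P2\<close> is
  itself proved by induction through this lemma.\<close>

lemma law_Suc_eq_Phi:
  assumes \<alpha>: "\<alpha> \<in> controls A" and \<mu>: "law \<alpha> k \<in> P2 borel"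
  shows "law \<alpha> (Suc k) = Phi (Suc k) (law \<alpha> k) (\<alpha> k)"
proof (rule measure_eqI)
  note h = controls_feedback[OF \<alpha>, of k]
  note pP = push_P2[OF \<mu> h]
  note K = kernel_measurable[OF \<mu> h, of k]
  note [measurable] = feedback_measurable[OF h] eps_measurable X_measurable[OF \<alpha>]
  let ?\<mu> = "law \<alpha> k" and ?D = "distr M borel (eps (Suc k))"
  interpret D: prob_space ?D by (rule prob_space_distr[OF eps_measurable])
  have sP: "sets (Phi (Suc k) ?\<mu> (\<alpha> k)) = sets borel"
    using P2_D(4)[OF Phi_P2[OF \<mu> h]] .
  show "sets (law \<alpha> (Suc k)) = sets (Phi (Suc k) ?\<mu> (\<alpha> k))"
    using sP by (simp add: law_def)
  fix B assume "B \<in> sets (law \<alpha> (Suc k))"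
  then have B[measurable]: "B \<in> sets borel" by (simp add: law_def)
  \<comment> \<open>The one-step map with both laws frozen, a function of state and innovation
    alone.\<close>
  define G where "G x e = F (Suc k) x ?\<mu> (\<alpha> k x) (push (\<alpha> k) ?\<mu>) e" for x e
  have G[measurable]: "(\<lambda>(x, e). G x e) \<in> borel_measurable (borel \<Otimes>\<^sub>M borel)"
    unfolding G_def case_prod_beta
    by (intro F_measurable_comp P2_D(1)[OF \<mu>] P2_D(1)[OF pP]) measurable
  have [measurable_cong]: "sets ?\<mu> = sets borel" by (simp add: law_def)
  have "emeasure (law \<alpha> (Suc k)) B = (\<integral>\<^sup>+\<omega>. indicator B (X \<alpha> (Suc k) \<omega>) \<partial>M)"
    unfolding law_def
    by (subst nn_integral_distr[symmetric, of _ _ borel]) (auto intro: X_measurable[OF \<alpha>] simp del: X.simps)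
  also have "\<dots> = (\<integral>\<^sup>+\<omega>. (\<lambda>(x, e). indicator B (G x e)) (X \<alpha> k \<omega>, eps (Suc k) \<omega>) \<partial>M)"
    by (simp only: X_Suc G_def act_law_eq_push[OF \<alpha>] case_prod_conv)
  also have "\<dots> = (\<integral>\<^sup>+z. (\<lambda>(x, e). indicator B (G x e)) z
        \<partial>distr M (borel \<Otimes>\<^sub>M borel) (\<lambda>\<omega>. (X \<alpha> k \<omega>, eps (Suc k) \<omega>)))"
    by (subst nn_integral_distr) measurable
  \<comment> \<open>Independence enters here; the next equality is Tonelli's theorem.\<close>
  also have "distr M (borel \<Otimes>\<^sub>M borel) (\<lambda>\<omega>. (X \<alpha> k \<omega>, eps (Suc k) \<omega>)) = ?\<mu> \<Otimes>\<^sub>M ?D"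
    by (rule distr_X_eps[OF \<alpha>])
  also have "(\<integral>\<^sup>+z. (\<lambda>(x, e). indicator B (G x e)) z \<partial>(?\<mu> \<Otimes>\<^sub>M ?D))
      = (\<integral>\<^sup>+x. \<integral>\<^sup>+e. indicator B (G x e) \<partial>?D \<partial>?\<mu>)"
  proof -
    have "(\<lambda>(x, e). indicator B (G x e) :: ennreal) \<in> borel_measurable (borel \<Otimes>\<^sub>M borel)"
      by measurable
    also have "borel_measurable (borel \<Otimes>\<^sub>M borel) = borel_measurable (?\<mu> \<Otimes>\<^sub>M ?D)"
      by (intro measurable_cong_sets sets_pair_measure_cong) (auto simp: law_def)
    finally show ?thesis
      by (subst D.nn_integral_fst[symmetric]) auto
  qed
  also have "\<dots> = (\<integral>\<^sup>+x. emeasure (kernel_P (Suc k) x ?\<mu> (\<alpha> k x) (push (\<alpha> k) ?\<mu>)) B \<partial>?\<mu>)"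
  proof (rule nn_integral_cong)
    fix x
    have Gx[measurable]: "G x \<in> borel_measurable borel"
      using measurable_compose[OF measurable_Pair1' G, of x] by simp
    have "(\<integral>\<^sup>+e. indicator B (G x e) \<partial>?D) = (\<integral>\<^sup>+\<omega>. indicator B (G x (eps (Suc k) \<omega>)) \<partial>M)"
      by (subst nn_integral_distr) auto
    also have "\<dots> = (\<integral>\<^sup>+y. indicator B y \<partial>distr M borel (\<lambda>\<omega>. G x (eps (Suc k) \<omega>)))"
      by (subst nn_integral_distr) auto
    finally show "(\<integral>\<^sup>+e. indicator B (G x e) \<partial>?D)
        = emeasure (kernel_P (Suc k) x ?\<mu> (\<alpha> k x) (push (\<alpha> k) ?\<mu>)) B"
      by (simp add: kernel_P_def G_def)
  qed
  also have "\<dots> = emeasure (Phi (Suc k) ?\<mu> (\<alpha> k)) B"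
    unfolding Phi_def by (rule emeasure_bind_prob_algebra[OF P2_D(1)[OF \<mu>] K B, symmetric])
  finally show "emeasure (law \<alpha> (Suc k)) B = emeasure (Phi (Suc k) ?\<mu> (\<alpha> k)) B" .
qed

text \<open>Square integrability of \<open>xi\<close> starts the induction, and
  \<open>Phi_P2\<close> carries it through each step.\<close>

lemma law_P2:
  assumes \<alpha>: "\<alpha> \<in> controls A"
  shows "law \<alpha> k \<in> P2 borel"
proof (induction k)
  case 0
  have "second_moment (law \<alpha> 0) = (\<integral>\<^sup>+\<omega>. ennreal ((norm (xi \<omega>))\<^sup>2) \<partial>M)"
    using xi_measurable by (simp add: law_def second_moment_distr)
  also have "\<dots> < \<infinity>"
    using xi_square_integrable by (simp add: integrable_iff_bounded)
  finally show ?case using law_prob_algebra[OF \<alpha>, of 0] by (simp add: P2_def)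
next
  case (Suc k)
  then show ?case by (simp add: law_Suc_eq_Phi[OF \<alpha>] Phi_P2 controls_feedback[OF \<alpha>])
qed

lemma law_Suc: "\<alpha> \<in> controls A \<Longrightarrow> law \<alpha> (Suc k) = Phi (Suc k) (law \<alpha> k) (\<alpha> k)"
  by (intro law_Suc_eq_Phi law_P2)

text \<open>The feedback at time j acts only on the step from j to \<open>Suc j\<close>. The strict
  bound j < k is what later allows the feedback at time k to be replaced without moving the law at
  time k.\<close>

lemma law_cong: "(\<And>j. j < k \<Longrightarrow> \<beta> j = \<alpha> j) \<Longrightarrow> law \<beta> k = law \<alpha> k"
proof -
  have "(\<forall>j<k. \<beta> j = \<alpha> j) \<Longrightarrow> X \<beta> k = X \<alpha> k" by (induction k) auto
  then show "(\<And>j. j < k \<Longrightarrow> \<beta> j = \<alpha> j) \<Longrightarrow> law \<beta> k = law \<alpha> k" by (simp add: law_def)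
qed

section \<open>Integrability of the costs and reduction of the cost to the laws\<close>

lemma running_cost_integrable:
  assumes k: "k < n" and \<mu>: "\<mu> \<in> P2 borel" and h: "h \<in> feedback A"
  shows "integrable \<mu> (\<lambda>x. f k x \<mu> (h x) (push h \<mu>))"
proof (rule integrableI_bounded)
  note pP = push_P2[OF \<mu> h]
  note [measurable_cong] = P2_D(4)[OF \<mu>]
  note [measurable] = feedback_measurable[OF h]
  have "(\<lambda>x. (x, \<mu>, h x, push h \<mu>)) \<in> \<mu> \<rightarrow>\<^sub>M
      borel \<Otimes>\<^sub>M restrict_space (prob_algebra borel) (P2 borel) \<Otimes>\<^sub>M act_space A
        \<Otimes>\<^sub>M restrict_space (prob_algebra (act_space A)) (P2 (act_space A))"
    using P2_D(1)[OF \<mu>] P2_D(1)[OF pP] \<mu> pP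
    by (intro measurable_Pair measurable_const) (auto simp: space_restrict_space)
  from measurable_compose[OF this f_measurable[OF k]]
  show "(\<lambda>x. f k x \<mu> (h x) (push h \<mu>)) \<in> borel_measurable \<mu>" by simp
  obtain C where C: "\<And>x a. a \<in> A \<Longrightarrow> ennreal \<bar>f k x \<mu> a (push h \<mu>)\<bar>
          \<le> ennreal C * (1 + ennreal ((norm x)\<^sup>2) + ennreal ((norm a)\<^sup>2)
               + second_moment \<mu> + second_moment (push h \<mu>))"
    using f_growth[OF k] \<mu> pP by blast
  show "(\<integral>\<^sup>+x. ennreal (norm (f k x \<mu> (h x) (push h \<mu>))) \<partial>\<mu>) < \<infinity>"
    by (rule le_less_trans[OF nn_integral_mono growth_integral_finite[OF \<mu> h, of C]])
      (use C[OF feedback_range[OF h]] in simp)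
qed

lemma terminal_cost_integrable:
  assumes \<mu>: "\<mu> \<in> P2 borel"
  shows "integrable \<mu> (\<lambda>x. g x \<mu>)"
proof (rule integrableI_bounded)
  note [measurable_cong] = P2_D(4)[OF \<mu>]
  have "(\<lambda>x. (x, \<mu>)) \<in> \<mu> \<rightarrow>\<^sub>M borel \<Otimes>\<^sub>M restrict_space (prob_algebra borel) (P2 borel)"
    using P2_D(1)[OF \<mu>] \<mu> by (intro measurable_Pair measurable_const) (auto simp: space_restrict_space)
  from measurable_compose[OF this g_measurable]
  show "(\<lambda>x. g x \<mu>) \<in> borel_measurable \<mu>" by simp
  obtain C where C: "\<And>x. ennreal \<bar>g x \<mu>\<bar> \<le> ennreal C * (1 + ennreal ((norm x)\<^sup>2) + second_moment \<mu>)"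
    using g_growth \<mu> by blast
  have "(\<integral>\<^sup>+x. ennreal (norm (g x \<mu>)) \<partial>\<mu>)
      \<le> (\<integral>\<^sup>+x. ennreal C * (1 + ennreal ((norm x)\<^sup>2) + second_moment \<mu>) \<partial>\<mu>)"
    by (rule nn_integral_mono) (use C in simp)
  also have "\<dots> = ennreal C * (1 + second_moment \<mu> + second_moment \<mu>)"
    using prob_space.emeasure_space_1[OF P2_D(3)[OF \<mu>]]
    by (simp add: nn_integral_cmult nn_integral_add second_moment_def[of \<mu>])
  also have "\<dots> < \<infinity>" using P2_D(2)[OF \<mu>] by (simp add: ennreal_mult_less_top)
  finally show "(\<integral>\<^sup>+x. ennreal (norm (g x \<mu>)) \<partial>\<mu>) < \<infinity>" .
qed

text \<open>The real number inside the infimum defining \<open>V\<close>.\<close>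

definition cost_to_go :: "nat \<Rightarrow> (nat \<Rightarrow> 'e \<Rightarrow> 'a) \<Rightarrow> real" where
  "cost_to_go k \<alpha> = (\<Sum>j=k..<n. fhat j (law \<alpha> j) (\<alpha> j)) + ghat (law \<alpha> n)"

lemma cost_to_go_n: "cost_to_go n \<alpha> = ghat (law \<alpha> n)"
  by (simp add: cost_to_go_def)

lemma cost_to_go_step:
  "k < n \<Longrightarrow> cost_to_go k \<alpha> = fhat k (law \<alpha> k) (\<alpha> k) + cost_to_go (Suc k) \<alpha>"
  by (simp add: cost_to_go_def sum.atLeast_Suc_lessThan)

text \<open>Linearity of the expectation, justified by integrability of each term, followed by a
  change of variables from the sample space to the law of the state.\<close>

lemma J_eq_cost_to_go:
  assumes \<alpha>: "\<alpha> \<in> controls A"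
  shows "J \<alpha> = cost_to_go 0 \<alpha>"
proof -
  have run: "integrable M (\<lambda>\<omega>. f k (X \<alpha> k \<omega>) (law \<alpha> k) (\<alpha> k (X \<alpha> k \<omega>)) (act_law \<alpha> k))"
    "expectation (\<lambda>\<omega>. f k (X \<alpha> k \<omega>) (law \<alpha> k) (\<alpha> k (X \<alpha> k \<omega>)) (act_law \<alpha> k)) = fhat k (law \<alpha> k) (\<alpha> k)"
    if k: "k < n" for k
  proof -
    let ?f = "\<lambda>x. f k x (law \<alpha> k) (\<alpha> k x) (push (\<alpha> k) (law \<alpha> k))"
    have int: "integrable (law \<alpha> k) ?f"
      by (rule running_cost_integrable[OF k law_P2[OF \<alpha>] controls_feedback[OF \<alpha>]])
    have m: "?f \<in> borel_measurable borel"
      using borel_measurable_integrable[OF int] by (simp add: law_def)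
    show "integrable M (\<lambda>\<omega>. f k (X \<alpha> k \<omega>) (law \<alpha> k) (\<alpha> k (X \<alpha> k \<omega>)) (act_law \<alpha> k))"
      using int integrable_distr[OF X_measurable[OF \<alpha>, of k], of ?f]
      unfolding act_law_eq_push[OF \<alpha>] by (metis law_def)
    show "expectation (\<lambda>\<omega>. f k (X \<alpha> k \<omega>) (law \<alpha> k) (\<alpha> k (X \<alpha> k \<omega>)) (act_law \<alpha> k)) = fhat k (law \<alpha> k) (\<alpha> k)"
      using integral_distr[OF X_measurable[OF \<alpha>, of k] m]
      unfolding act_law_eq_push[OF \<alpha>] fhat_def by (metis law_def)
  qed
  have int: "integrable (law \<alpha> n) (\<lambda>x. g x (law \<alpha> n))"
    by (rule terminal_cost_integrable[OF law_P2[OF \<alpha>]])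
  have m: "(\<lambda>x. g x (law \<alpha> n)) \<in> borel_measurable borel"
    using borel_measurable_integrable[OF int] by (simp add: law_def)
  have "integrable M (\<lambda>\<omega>. g (X \<alpha> n \<omega>) (law \<alpha> n))"
    using int integrable_distr[OF X_measurable[OF \<alpha>, of n], of "\<lambda>x. g x (law \<alpha> n)"]
    by (metis law_def)
  moreover have "expectation (\<lambda>\<omega>. g (X \<alpha> n \<omega>) (law \<alpha> n)) = ghat (law \<alpha> n)"
    using integral_distr[OF X_measurable[OF \<alpha>, of n] m] unfolding ghat_def by (metis law_def)
  moreover have "integrable M (\<lambda>\<omega>. \<Sum>k<n. f k (X \<alpha> k \<omega>) (law \<alpha> k) (\<alpha> k (X \<alpha> k \<omega>)) (act_law \<alpha> k))"
    using run(1) by (intro Bochner_Integration.integrable_sum) auto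
  moreover have "expectation (\<lambda>\<omega>. \<Sum>k<n. f k (X \<alpha> k \<omega>) (law \<alpha> k) (\<alpha> k (X \<alpha> k \<omega>)) (act_law \<alpha> k))
      = (\<Sum>k<n. fhat k (law \<alpha> k) (\<alpha> k))"
    using run by (subst Bochner_Integration.integral_sum) auto
  ultimately show ?thesis
    by (simp add: J_def cost_to_go_def atLeast0LessThan)
qed

text \<open>At time 0 no feedback is prescribed, so \<alpha> is arbitrary.\<close>

lemma V0_eq_V: "V0 = V 0 \<alpha>"
  unfolding V0_def V_def by (rule INF_cong) (auto simp: controls_upto_def J_eq_cost_to_go cost_to_go_def)

text \<open>A constant map with value \<open>a\<close> has linear growth with constant
  \<open>norm a\<close>.\<close>

lemma feedback_nonempty: "(feedback A :: ('e \<Rightarrow> 'a) set) \<noteq> {}"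
proof -
  obtain a where a: "a \<in> A" using A_nonempty by blast
  have "norm a \<le> norm a * (1 + norm (x::'e))" for x by (simp add: mult_le_cancel_left1)
  then have "(\<lambda>x::'e. a) \<in> feedback A"
    using a unfolding feedback_def by (auto simp: space_restrict_space intro!: exI[of _ "norm a"])
  then show ?thesis by blast
qed

end

subsection \<open>Dynamic programming\<close>

text \<open>The recursion is stated in \<open>ereal\<close>, where the infimum is always the true
  one; equating it with a real number expresses that it is finite.\<close>

locale bellman_solution = mkv_control M A xi eps F f g n
  for M :: "'o measure" and A :: "'a::real_normed_vector set"
    and xi :: "'o \<Rightarrow> 'e::real_normed_vector" and eps :: "nat \<Rightarrow> 'o \<Rightarrow> real ^ 'd"
    and F f g n +
  fixes w :: "nat \<Rightarrow> 'e measure \<Rightarrow> real"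
  assumes w_terminal: "\<And>\<mu>. \<mu> \<in> P2 borel \<Longrightarrow> w n \<mu> = ghat \<mu>"
    and w_step: "\<And>k \<mu>. k < n \<Longrightarrow> \<mu> \<in> P2 borel \<Longrightarrow>
      ereal (w k \<mu>) = (INF h\<in>feedback A. ereal (fhat k \<mu> h + w (Suc k) (Phi (Suc k) \<mu> h)))"
begin

lemma w_le:
  assumes "k < n" "\<mu> \<in> P2 borel" "h \<in> feedback A"
  shows "w k \<mu> \<le> fhat k \<mu> h + w (Suc k) (Phi (Suc k) \<mu> h)"
proof -
  have "ereal (w k \<mu>) \<le> ereal (fhat k \<mu> h + w (Suc k) (Phi (Suc k) \<mu> h))"
    unfolding w_step[OF assms(1,2)] by (rule INF_lower[OF assms(3)])
  then show ?thesis by simp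
qed

text \<open>As \<open>w k \<mu>\<close> is finite, adding \<open>e\<close> strictly exceeds the
  infimum, so some feedback function lies below that level.\<close>

lemma w_near_minimizer:
  assumes "k < n" "\<mu> \<in> P2 borel" "0 < e"
  shows "\<exists>h\<in>feedback A. fhat k \<mu> h + w (Suc k) (Phi (Suc k) \<mu> h) < w k \<mu> + e"
proof -
  have "(INF h\<in>feedback A. ereal (fhat k \<mu> h + w (Suc k) (Phi (Suc k) \<mu> h))) < ereal (w k \<mu> + e)"
    using assms by (simp flip: w_step)
  then show ?thesis by (simp add: INF_less_iff)
qed

text \<open>Backward induction from \<open>n\<close>: the feedback in use is one competitor in the
  infimum, and \<open>law_Suc\<close> identifies \<open>Phi\<close> with the next law.\<close>

lemma w_le_cost_to_go:
  assumes "k \<le> n" "\<alpha> \<in> controls A"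
  shows "w k (law \<alpha> k) \<le> cost_to_go k \<alpha>"
  using assms(1)
proof (induction rule: inc_induct)
  case base
  show ?case by (simp add: cost_to_go_n w_terminal law_P2 assms)
next
  case (step k)
  then show ?case
    using w_le[OF _ law_P2[OF assms(2)] controls_feedback[OF assms(2)], of k k k]
    by (simp add: cost_to_go_step law_Suc[OF assms(2)])
qed

text \<open>Backward induction spending half of the tolerance on the feedback at time k and half on
  the tail. The control is generalised because the induction hypothesis is applied to a modified
  one.\<close>

lemma near_optimal_control:
  assumes "k \<le> n" "\<alpha> \<in> controls A" "0 < e"
  shows "\<exists>\<beta>\<in>controls_upto A k \<alpha>. cost_to_go k \<beta> < w k (law \<alpha> k) + e"
  using assms
proof (induction arbitrary: \<alpha> e rule: inc_induct)
  case base
  then show ?case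
    by (intro bexI[of _ \<alpha>]) (auto simp: cost_to_go_n w_terminal law_P2 controls_upto_def)
next
  case (step k)
  then have k: "k < n" by simp
  obtain h where h: "h \<in> feedback A"
    "fhat k (law \<alpha> k) h + w (Suc k) (Phi (Suc k) (law \<alpha> k) h) < w k (law \<alpha> k) + e / 2"
    using w_near_minimizer[OF k law_P2[OF step.prems(1)], of "e / 2"] step.prems by auto
  \<comment> \<open>Inserting \<open>h\<close> at time k forces the tail control, which must agree
    with \<alpha>' before \<open>Suc k\<close>, to use \<open>h\<close> there.\<close>
  define \<alpha>' where "\<alpha>' = \<alpha>(k := h)"
  have \<alpha>': "\<alpha>' \<in> controls A" using controls_fun_upd step h by (simp add: \<alpha>'_def)
  obtain \<beta> where \<beta>: "\<beta> \<in> controls_upto A (Suc k) \<alpha>'"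
    "cost_to_go (Suc k) \<beta> < w (Suc k) (law \<alpha>' (Suc k)) + e / 2"
    using step.IH[OF \<alpha>', of "e / 2"] step.prems by auto
  have agree: "law \<alpha>' k = law \<alpha> k" "law \<beta> k = law \<alpha> k"
    using \<beta> by (auto intro!: law_cong simp: controls_upto_def \<alpha>'_def)
  have "\<beta> k = h" "\<alpha>' k = h" "\<beta> \<in> controls_upto A k \<alpha>"
    using \<beta> by (auto simp: controls_upto_def \<alpha>'_def)
  then show ?case
    using h \<beta> agree by (intro bexI[of _ \<beta>]) (auto simp: cost_to_go_step[OF k] law_Suc[OF \<alpha>'])
qed

text \<open>All competitors in \<open>V k \<alpha>\<close> share the law at time k by
  \<open>law_cong\<close>, so \<open>w\<close> at that law is a lower bound for each, and
  near-optimal controls show that it is sharp.\<close>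

lemma V_eq_w:
  assumes "k \<le> n" "\<alpha> \<in> controls A"
  shows "V k \<alpha> = ereal (w k (law \<alpha> k))"
proof (rule antisym)
  show "V k \<alpha> \<le> ereal (w k (law \<alpha> k))"
  proof (rule ereal_le_epsilon2)
    fix e :: real assume "0 < e"
    with near_optimal_control[OF assms] obtain \<beta> where
      "\<beta> \<in> controls_upto A k \<alpha>" "cost_to_go k \<beta> < w k (law \<alpha> k) + e" by blast
    then show "V k \<alpha> \<le> ereal (w k (law \<alpha> k)) + ereal e"
      unfolding V_def by (intro INF_lower2[of \<beta>]) (auto simp: cost_to_go_def)
  qed
  show "ereal (w k (law \<alpha> k)) \<le> V k \<alpha>"
    unfolding V_def
  proof (rule INF_greatest)
    fix \<beta> assume "\<beta> \<in> controls_upto A k \<alpha>"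
    then have "\<beta> \<in> controls A" "law \<beta> k = law \<alpha> k"
      by (auto intro!: law_cong simp: controls_upto_def)
    with w_le_cost_to_go[OF assms(1), of \<beta>]
    show "ereal (w k (law \<alpha> k)) \<le> ereal ((\<Sum>j=k..<n. fhat j (law \<beta> j) (\<beta> j)) + ghat (law \<beta> n))"
      by (simp add: cost_to_go_def)
  qed
qed

text \<open>Both recursions are compared directly, without the state process; \<open>Phi_P2\<close>
  keeps the arguments in \<open>P2\<close>, where the induction hypothesis applies.\<close>

lemma v_eq_w:
  assumes "k \<le> n" "\<mu> \<in> P2 borel"
  shows "v k \<mu> = ereal (w k \<mu>)"
  using assms
proof (induction arbitrary: \<mu> rule: inc_induct)
  case base
  then show ?case by (subst v.simps) (simp add: w_terminal)
next
  case (step k)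
  then show ?case
    by (subst v.simps) (auto simp: w_step step.IH Phi_P2 intro!: INF_cong)
qed

section \<open>Optimality of the closed-loop control\<close>

context
  fixes astar :: "nat \<Rightarrow> 'e measure \<Rightarrow> 'e \<Rightarrow> 'a"
  assumes astar: "\<forall>k<n. \<forall>\<mu>\<in>P2 borel. astar k \<mu> \<in> feedback A \<and>
    w k \<mu> = fhat k \<mu> (astar k \<mu>) + w (Suc k) (Phi (Suc k) \<mu> (astar k \<mu>))"
begin

text \<open>The equation is implicit, since the law depends on the control, but the law at time k
  sees only earlier feedbacks. The control is therefore built one entry at a time.\<close>

lemma closed_loop_control_exists:
  "\<exists>\<alpha>\<in>controls A. \<forall>k<n. \<alpha> k = astar k (law \<alpha> k)"
proof -
  have "\<exists>\<alpha>\<in>controls A. \<forall>k<m. \<alpha> k = astar k (law \<alpha> k)" if "m \<le> n" for m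
    using that
  proof (induction m)
    case 0
    \<comment> \<open>An arbitrary filler: entries before \<open>n\<close> are overwritten in turn
      and later ones do not affect the cost.\<close>
    obtain h :: "'e \<Rightarrow> 'a" where "h \<in> feedback A" using feedback_nonempty by blast
    then show ?case by (intro bexI[of _ "\<lambda>k. h"]) (auto simp: controls_def)
  next
    case (Suc m)
    then obtain \<alpha> where \<alpha>: "\<alpha> \<in> controls A" "\<forall>k<m. \<alpha> k = astar k (law \<alpha> k)" by auto
    define \<beta> where "\<beta> = \<alpha>(m := astar m (law \<alpha> m))"
    have "law \<beta> k = law \<alpha> k" if "k \<le> m" for k
      using that by (intro law_cong) (auto simp: \<beta>_def)
    then have "\<forall>k<Suc m. \<beta> k = astar k (law \<beta> k)"
      using \<alpha>(2) by (auto simp: less_Suc_eq \<beta>_def)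
    moreover have "\<beta> \<in> controls A"
      unfolding \<beta>_def using astar Suc.prems law_P2[OF \<alpha>(1)] by (intro controls_fun_upd \<alpha>(1)) auto
    ultimately show ?case by blast
  qed
  then show ?thesis by blast
qed

text \<open>With exact minimisers the backward induction of \<open>w_le_cost_to_go\<close> runs with
  equalities; at time 0 it reads \<open>J \<alpha>\<close> = \<open>V0\<close>.\<close>

lemma closed_loop_control_optimal:
  assumes \<alpha>: "\<alpha> \<in> controls A" and loop: "\<forall>k<n. \<alpha> k = astar k (law \<alpha> k)"
  shows "V0 = ereal (J \<alpha>)"
proof -
  have "cost_to_go k \<alpha> = w k (law \<alpha> k)" if "k \<le> n" for k
    using that
  proof (induction rule: inc_induct)
    case base
    show ?case by (simp add: cost_to_go_n w_terminal law_P2[OF \<alpha>])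
  next
    case (step k)
    have "w k (law \<alpha> k) = fhat k (law \<alpha> k) (astar k (law \<alpha> k))
        + w (Suc k) (Phi (Suc k) (law \<alpha> k) (astar k (law \<alpha> k)))"
      using astar step.hyps law_P2[OF \<alpha>] by blast
    moreover have "astar k (law \<alpha> k) = \<alpha> k" using loop step.hyps by simp
    ultimately show ?case
      using step by (simp add: cost_to_go_step law_Suc[OF \<alpha>])
  qed
  from this[of 0] show ?thesis
    by (simp add: V0_eq_V[of \<alpha>] V_eq_w[OF _ \<alpha>] J_eq_cost_to_go[OF \<alpha>])
qed

end

end

text \<open>The closed-loop equation fixes a control only before time \<open>n\<close>, hence
  existence is stated separately and optimality for every solution.\<close>

theorem theorem3p2:
  fixes M :: "'o measure"
    and A :: "'a::real_normed_vector set"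
    and xi :: "'o \<Rightarrow> 'e::real_normed_vector"
    and eps :: "nat \<Rightarrow> 'o \<Rightarrow> real ^ 'd"
    and F :: "nat \<Rightarrow> 'e \<Rightarrow> 'e measure \<Rightarrow> 'a \<Rightarrow> 'a measure \<Rightarrow> real ^ 'd \<Rightarrow> 'e"
    and f :: "nat \<Rightarrow> 'e \<Rightarrow> 'e measure \<Rightarrow> 'a \<Rightarrow> 'a measure \<Rightarrow> real"
    and g :: "'e \<Rightarrow> 'e measure \<Rightarrow> real"
    and n :: nat
    and w :: "nat \<Rightarrow> 'e measure \<Rightarrow> real"
  assumes setting: "mkv_control M A xi eps F f g n"
    and w_terminal: "\<And>\<mu>. \<mu> \<in> P2 borel \<Longrightarrow> w n \<mu> = mkv_control.ghat g \<mu>"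
    and w_step: "\<And>k \<mu>. k < n \<Longrightarrow> \<mu> \<in> P2 borel \<Longrightarrow>
      ereal (w k \<mu>) = (INF h\<in>feedback A.
        ereal (mkv_control.fhat A f k \<mu> h + w (Suc k) (mkv_control.Phi M A eps F (Suc k) \<mu> h)))"
  shows "(\<forall>k\<le>n. \<forall>\<alpha>\<in>controls A.
            mkv_control.V M A xi eps F f g n k \<alpha> = ereal (w k (mkv_control.law M A xi eps F \<alpha> k)))
       \<and> (\<forall>k\<le>n. \<forall>\<mu>\<in>P2 borel. ereal (w k \<mu>) = mkv_control.v M A eps F f g n k \<mu>)
       \<and> (\<forall>astar :: nat \<Rightarrow> 'e measure \<Rightarrow> 'e \<Rightarrow> 'a.
            (\<forall>k<n. \<forall>\<mu>\<in>P2 borel. astar k \<mu> \<in> feedback A \<and>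
               w k \<mu> = mkv_control.fhat A f k \<mu> (astar k \<mu>)
                 + w (Suc k) (mkv_control.Phi M A eps F (Suc k) \<mu> (astar k \<mu>)))
            \<longrightarrow> (\<exists>\<alpha>\<in>controls A. \<forall>k<n. \<alpha> k = astar k (mkv_control.law M A xi eps F \<alpha> k))
              \<and> (\<forall>\<alpha>\<in>controls A. (\<forall>k<n. \<alpha> k = astar k (mkv_control.law M A xi eps F \<alpha> k))
                   \<longrightarrow> mkv_control.V0 M A xi eps F f g n = ereal (mkv_control.J M A xi eps F f g n \<alpha>)))"
proof -
  interpret mkv_control M A xi eps F f g n by (rule setting)
  interpret bellman_solution M A xi eps F f g n w
    using w_terminal w_step by unfold_locales auto
  show ?thesis
    using V_eq_w v_eq_w closed_loop_control_exists closed_loop_control_optimal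
    by (intro conjI allI impI ballI) (simp_all, blast+)
qed

end
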